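(* Let $A$ be a Frobenius algebra over a field $\Bbbk$ with respect to a non-degenerate associative bilinear form $\langle-,-\rangle$, with Nakayama automorphism $\sigma$, and let $\delta:A\to A$ be a derivation. There is a unique element $\mathrm{div}_\sigma(\delta)$ of $A$ such that for all $a$ and $b$ in $A$ we have $$\langle\delta(a),b\rangle+\langle a,\delta(b)\rangle=\langle a,b\cdot\mathrm{div}_\sigma(\delta)\rangle.$$ If the bilinear form on $A$ is symmetric, then that element is central in $A$.
   Context: $\Bbbk$ is a field; algebras are associative and unital over $\Bbbk$, and derivations are $\Bbbk$-linear. A Frobenius algebra is a finite-dimensional algebra $A$ endowed with a non-degenerate bilinear form $\langle-,-\rangle:A\times A\to\Bbbk$ that is associative: $\langle ab,c\rangle=\langle a,bc\rangle$ for all $a,b,c\in A$. Its Nakayama automorphism is the unique algebra automorphism $\sigma:A\to A$ such that $\langle a,b\rangle=\langle b,\sigma(a)\rangle$ for all $a,b\in A$. The element $\mathrm{div}_\sigma(\delta)$ is called the Nakayama divergence of $\delta$. *)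

theory Defs
  imports Complex_Main
begin

text \<open>
  The sort \<open>{ring, monoid_mult}\<close> is used for algebras instead of \<open>ring_1\<close> so that the
  zero algebra is not excluded.
\<close>

locale unital_algebra = vector_space scale
  for scale :: "'k::field \<Rightarrow> 'a::{ring, monoid_mult} \<Rightarrow> 'a" +
  assumes scale_mult_left: "scale c x * y = scale c (x * y)"
    and scale_mult_right: "x * scale c y = scale c (x * y)"

locale frobenius_algebra = unital_algebra scale
  for scale :: "'k::field \<Rightarrow> 'a::{ring, monoid_mult} \<Rightarrow> 'a" +
  fixes form :: "'a \<Rightarrow> 'a \<Rightarrow> 'k"
  assumes finite_dimensional: "\<exists>B. finite B \<and> span B = UNIV"
    and linear_form_right: "Vector_Spaces.linear scale (*) (\<lambda>y. form x y)"
    and linear_form_left: "Vector_Spaces.linear scale (*) (\<lambda>x. form x y)"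
    and nondegenerate_left: "(\<And>y. form x y = 0) \<Longrightarrow> x = 0"
    and nondegenerate_right: "(\<And>x. form x y = 0) \<Longrightarrow> y = 0"
    and form_assoc: "form (x * y) z = form x (y * z)"

definition algebra_automorphism ::
  "('k::field \<Rightarrow> 'a::{ring, monoid_mult} \<Rightarrow> 'a) \<Rightarrow> ('a \<Rightarrow> 'a) \<Rightarrow> bool" where
  "algebra_automorphism scale \<sigma> \<longleftrightarrow>
     Vector_Spaces.linear scale scale \<sigma> \<and> bij \<sigma> \<and> \<sigma> 1 = 1 \<and> (\<forall>a b. \<sigma> (a * b) = \<sigma> a * \<sigma> b)"

definition nakayama_automorphism ::
  "('k::field \<Rightarrow> 'a::{ring, monoid_mult} \<Rightarrow> 'a) \<Rightarrow> ('a \<Rightarrow> 'a \<Rightarrow> 'k) \<Rightarrow> ('a \<Rightarrow> 'a) \<Rightarrow> bool" where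
  "nakayama_automorphism scale form \<sigma> \<longleftrightarrow>
     algebra_automorphism scale \<sigma> \<and> (\<forall>a b. form a b = form b (\<sigma> a))"

definition derivation ::
  "('k::field \<Rightarrow> 'a::{ring, monoid_mult} \<Rightarrow> 'a) \<Rightarrow> ('a \<Rightarrow> 'a) \<Rightarrow> bool" where
  "derivation scale \<delta> \<longleftrightarrow>
     Vector_Spaces.linear scale scale \<delta> \<and> (\<forall>a b. \<delta> (a * b) = \<delta> a * b + a * \<delta> b)"

text \<open>
  The usual notation carries the Nakayama automorphism as an index, but the defining identity
  only involves the form, which determines that automorphism.
\<close>

definition nakayama_divergence ::
  "('a::{ring, monoid_mult} \<Rightarrow> 'a \<Rightarrow> 'k::field) \<Rightarrow> ('a \<Rightarrow> 'a) \<Rightarrow> 'a" where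
  "nakayama_divergence form \<delta> =
     (THE d. \<forall>a b. form (\<delta> a) b + form a (\<delta> b) = form a (b * d))"

context frobenius_algebra
begin

lemma form_right:
  "form x (y + z) = form x y + form x z" "form x (scale c y) = c * form x y"
  using linear_form_right[of x] by (auto simp: Vector_Spaces.linear_iff)

lemma form_left:
  "form (x + y) z = form x z + form y z" "form (scale c x) z = c * form x z"
  using linear_form_left[of z] by (auto simp: Vector_Spaces.linear_iff)

lemma form_eqD:
  assumes "\<And>x. form x y = form x z"
  shows "y = z"
proof -
  have "form x (y - z) = 0" for x
    using form_right(1)[of x "y - z" z] assms by simp
  then show ?thesis
    using nondegenerate_right[of "y - z"] by simp
qed

lemma finite_basis: "\<exists>B. finite_dimensional_vector_space scale B"
proof -
  obtain S where S: "finite S" "span S = UNIV"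
    using finite_dimensional by blast
  obtain B where B: "B \<subseteq> S" "independent B" "S \<subseteq> span B"
    using maximal_independent_subset[of S] by metis
  have "span B = UNIV"
    using span_mono[OF B(3)] S(2) by (auto simp: span_span)
  moreover have "finite B" using B(1) S(1) finite_subset by blast
  ultimately have "finite_dimensional_vector_space scale B"
    using B(2) by unfold_locales auto
  then show ?thesis ..
qed

lemma functional_represented:
  assumes f: "Vector_Spaces.linear scale (*) f"
  shows "\<exists>y. \<forall>x. f x = form x y"
proof -
  obtain B where "finite_dimensional_vector_space scale B"
    using finite_basis by blast
  then interpret fd: finite_dimensional_vector_space scale B .
  note fB = fd.finite_Basis and iB = fd.independent_Basis and sB = fd.span_Basis
  interpret vp: vector_space_pair scale "(*) :: 'k \<Rightarrow> 'k \<Rightarrow> 'k"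
    using linear_form_right[of 0] by (simp add: Vector_Spaces.linear_def vector_space_pair_def)
  define T where "T y = (\<Sum>b\<in>B. scale (form b y) b)" for y
  have linT: "Vector_Spaces.linear scale scale T"
    unfolding Vector_Spaces.linear_iff
    by (auto simp: T_def form_right scale_left_distrib sum.distrib scale_sum_right vector_space_axioms)
  have coeff: "g = h"
    if "(\<Sum>b\<in>B. scale (g b) b) = (\<Sum>b\<in>B. scale (h b) b)" "\<And>b. b \<notin> B \<Longrightarrow> g b = h b" for g h
  proof
    fix b
    have "(\<Sum>b\<in>B. scale (g b - h b) b) = 0"
      using that(1) by (simp add: scale_left_diff_distrib sum_subtractf)
    then have "b \<in> B \<Longrightarrow> g b - h b = 0"
      using independentD[OF iB fB order_refl, of "\<lambda>b. g b - h b"] by blast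
    then show "g b = h b" using that(2) by auto
  qed
  have ext: "\<forall>x. g x = h x"
    if "Vector_Spaces.linear scale (*) g" "Vector_Spaces.linear scale (*) h" "\<And>b. b \<in> B \<Longrightarrow> g b = h b"
    for g h
    using vp.linear_eq_on[OF that(1,2), of _ B] that(3) sB by auto
  have Tcoeff: "form b y = g b" if "T y = (\<Sum>b\<in>B. scale (g b) b)" "b \<in> B" for y g b
    using fun_cong[OF coeff[of "\<lambda>b. if b \<in> B then form b y else 0" "\<lambda>b. if b \<in> B then g b else 0"], of b]
      that by (simp add: T_def)
  have "inj T"
  proof (rule injI)
    fix y z assume "T y = T z"
    then have "form b y = form b z" if "b \<in> B" for b
      using Tcoeff[of y "\<lambda>b. form b z"] that by (simp add: T_def)
    then show "y = z"
      using ext[OF linear_form_left linear_form_left] form_eqD by blast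
  qed
  then have "surj T" using linT fd.linear_inj_imp_surj by blast
  then obtain y where "T y = (\<Sum>b\<in>B. scale (f b) b)" by (metis surjD)
  then have "f b = form b y" if "b \<in> B" for b using Tcoeff that by simp
  then show ?thesis using ext[OF f linear_form_left] by blast
qed

lemma ex1_nakayama_automorphism: "\<exists>!\<sigma>. nakayama_automorphism scale form \<sigma>"
proof -
  have "\<exists>\<sigma>. \<forall>a b. form a b = form b (\<sigma> a)"
    using functional_represented[OF linear_form_right] by metis
  then obtain \<sigma> where \<sigma>: "form b (\<sigma> a) = form a b" for a b by metis
  have lin: "Vector_Spaces.linear scale scale \<sigma>"
    unfolding Vector_Spaces.linear_iff
    by (auto intro!: form_eqD simp: \<sigma> form_right form_left vector_space_axioms)
  have mult: "\<sigma> (a * c) = \<sigma> a * \<sigma> c" for a c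
  proof (rule form_eqD)
    fix b
    have "form b (\<sigma> (a * c)) = form a (c * b)" by (simp add: \<sigma> form_assoc)
    also have "\<dots> = form c (b * \<sigma> a)" by (metis \<sigma> form_assoc)
    also have "\<dots> = form b (\<sigma> a * \<sigma> c)" by (metis \<sigma> form_assoc)
    finally show "form b (\<sigma> (a * c)) = form b (\<sigma> a * \<sigma> c)" .
  qed
  have one: "\<sigma> 1 = 1"
    by (rule form_eqD) (metis \<sigma> form_assoc mult.left_neutral mult.right_neutral)
  have "inj \<sigma>"
  proof (rule injI)
    fix x y assume "\<sigma> x = \<sigma> y"
    then have "form x b = form y b" for b by (metis \<sigma>)
    then have "form (x - y) b = 0" for b
      using form_left(1)[of "x - y" y b] by simp
    then show "x = y" using nondegenerate_left[of "x - y"] by simp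
  qed
  moreover have "surj \<sigma>"
  proof -
    obtain B where "finite_dimensional_vector_space scale B"
      using finite_basis by blast
    then interpret fd: finite_dimensional_vector_space scale B .
    show ?thesis using fd.linear_inj_imp_surj lin \<open>inj \<sigma>\<close> by blast
  qed
  ultimately have "nakayama_automorphism scale form \<sigma>"
    using lin mult one \<sigma>
    by (simp add: nakayama_automorphism_def algebra_automorphism_def bij_def)
  moreover have "\<tau> = \<sigma>" if "nakayama_automorphism scale form \<tau>" for \<tau>
    using that form_eqD \<sigma> unfolding nakayama_automorphism_def by (metis ext)
  ultimately show ?thesis by blast
qed

end

end

theory Submission
  imports Defs
begin

text \<open>
  Associativity of the form and the Leibniz rule give
  \<open>\<langle>\<delta> a, b\<rangle> + \<langle>a, \<delta> b\<rangle> = \<langle>\<delta> (a b), 1\<rangle>\<close>, so the divergence is the element representing the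
  functional \<open>x \<mapsto> \<langle>\<delta> x, 1\<rangle>\<close>. When the form is symmetric, this expression is symmetric in \<open>a\<close> and
  \<open>b\<close>, so the functional vanishes on commutators, which means that its representing element is
  central.
\<close>

context frobenius_algebra
begin

lemma form_derivation:
  assumes "derivation scale \<delta>"
  shows "form (\<delta> a) b + form a (\<delta> b) = form (\<delta> (a * b)) 1"
  using assms by (simp add: derivation_def form_left form_assoc)

lemma linear_form_derivation_one:
  assumes "derivation scale \<delta>"
  shows "Vector_Spaces.linear scale (*) (\<lambda>x. form (\<delta> x) 1)"
proof -
  have "Vector_Spaces.linear scale scale \<delta>"
    using assms by (simp add: derivation_def)
  then show ?thesis
    using Vector_Spaces.linear_compose[OF _ linear_form_left[of 1], of scale \<delta>]
    by (simp add: o_def)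
qed

lemma ex1_divergence:
  assumes "derivation scale \<delta>"
  shows "\<exists>!d. \<forall>a b. form (\<delta> a) b + form a (\<delta> b) = form a (b * d)"
proof (rule ex_ex1I)
  obtain d where d: "\<And>x. form (\<delta> x) 1 = form x d"
    using functional_represented[OF linear_form_derivation_one[OF assms]] by blast
  show "\<exists>d. \<forall>a b. form (\<delta> a) b + form a (\<delta> b) = form a (b * d)"
    by (rule exI[of _ d]) (simp add: form_derivation[OF assms] d form_assoc)
next
  fix d e
  assume "\<forall>a b. form (\<delta> a) b + form a (\<delta> b) = form a (b * d)"
    and "\<forall>a b. form (\<delta> a) b + form a (\<delta> b) = form a (b * e)"
  \<comment> \<open>Setting \<open>b = 1\<close> in both identities gives equal left-hand sides, and
    nondegeneracy then separates elements.\<close>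
  then have "form a (1 * d) = form a (1 * e)" for a
    by metis
  then show "d = e"
    by (intro form_eqD) simp
qed

lemma central_of_symmetric:
  assumes sym: "\<And>a b. form a b = form b a"
    and d: "\<And>a b. form (\<delta> a) b + form a (\<delta> b) = form a (b * d)"
  shows "d * x = x * d"
proof (rule form_eqD)
  fix a
  \<comment> \<open>A symmetric associative form is invariant under cyclic rotation of a
    product.\<close>
  have "form a (d * x) = form x (a * d)"
    by (metis sym form_assoc)
  \<comment> \<open>By symmetry, the identity for the pair \<open>x\<close>, \<open>a\<close> and
    the one for \<open>a\<close>, \<open>x\<close> have the same left-hand side.\<close>
  also have "\<dots> = form a (x * d)"
    using d[of x a] d[of a x] by (metis sym add.commute)
  finally show "form a (d * x) = form a (x * d)" .
qed

end

theorem proposition8: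
  fixes scale :: "'k::field \<Rightarrow> 'a::{ring, monoid_mult} \<Rightarrow> 'a"
    and form :: "'a \<Rightarrow> 'a \<Rightarrow> 'k"
    and \<sigma> \<delta> :: "'a \<Rightarrow> 'a"
  assumes "frobenius_algebra scale form"
    and "nakayama_automorphism scale form \<sigma>"
    and "derivation scale \<delta>"
  shows "(\<exists>!d. \<forall>a b. form (\<delta> a) b + form a (\<delta> b) = form a (b * d)) \<and>
    ((\<forall>a b. form a b = form b a) \<longrightarrow>
       (\<forall>x. nakayama_divergence form \<delta> * x = x * nakayama_divergence form \<delta>))"
proof -
  interpret frobenius_algebra scale form by fact
  note ex1 = ex1_divergence[OF assms(3)]
  have "form (\<delta> a) b + form a (\<delta> b) = form a (b * nakayama_divergence form \<delta>)" for a b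
    using theI'[OF ex1] unfolding nakayama_divergence_def by blast
  then show ?thesis
    using ex1 central_of_symmetric by blast
qed

end
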